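(* Let $R$ be an authentic execution (as defined in the context) of Algorithm A (given in the context), in which, as the consensus task demands, every processor that does not crash proposes a value. Let $a_i\in R$ be the first step in $R$ that includes an invocation of $\mathsf{propose}_i(v_i)$, say by $p_i\in\mathcal P$, and suppose that $v_i\ne\bot$ holds in any system state of $R$. Then there exists $v\notin\{\bot,\text{ERR}\}$ such that, for every correct processor $p_j\in\mathcal P$, $\mathsf{result}_j()$ (eventually) returns $v$ within $n$ invocations of binary consensus (i.e., with each processor invoking $\mathsf{binPropose}$ on at most $n$ binary consensus objects).
   Context: **System.** An asynchronous message-passing system has $n$ processors $\mathcal P=\{p_0,\dots,p_{n-1}\}$. At most $t<n/2$ of them crash; $\mathit{Correct}$ is the set of indices of processors that never crash. There are no bounds on delays and no clocks. Channels have bounded capacity and may omit, duplicate and reorder packets. They satisfy fair communication: a message sent infinitely often by $p_i$ to $p_j$ is received infinitely often. An execution is an alternating sequence of system states and atomic steps. **Assumed building blocks.** - *Uniform reliable broadcast (URB).* $\mathsf{urbBroadcast}\ m$ returns a descriptor $\mathit{txDes}$. URB-validity: no spontaneous creation or alteration of messages. URB-integrity: no duplication. URB-termination: if the sender is correct, or some processor URB-delivers $m$, then all correct processors URB-deliver $m$. The predicate $\mathsf{hasTerminated}(\mathit{txDes})$ holds once the sender knows that all non-failing processors have delivered the message. By URB-termination, it eventually holds at a correct sender. - *Binary consensus objects* $BC[k]$, $k\in\{0,\dots,n-1\}$. $BC[k]=\bot$ means inactive. $\mathsf{binPropose}(k,b)$ with $b\in\{\mathsf{True},\mathsf{False}\}$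 activates $BC[k]$ and proposes $b$. $BC[k].\mathsf{result}(k)$ returns $\bot$ if there is no decision yet, and otherwise the decided value. The objects satisfy validity (a decided value was proposed), agreement, integrity (no processor decides twice) and termination (an active object at a correct processor eventually has a decision there). **Algorithm A (code for $p_i$).** There is a single multivalued consensus object $O$ (local copy $O_i$). $O=\bot$ means inactive and $O\ne\bot$ means active. The fields of $O$ are: - $v$, the proposed value; - $\mathit{proposals}[0..n-1]$; - $BC[0..n-1]$, binary consensus objects; - $\mathit{txDes}$; - the Boolean $\mathit{oneTerm}$. The symbol $\bot$ is a special non-value, and ERR (the paper's "transient error" symbol) is another special symbol. Proposable values belong to a finite set $V$ with $\bot,\text{ERR}\notin V$. Let $S(x)=\{0,\dots,x\}$ and $\mathsf K=\{k\in S(n-1): O.BC[k]\ne\bot\wedge O.BC[k].\mathsf{result}(k)=\mathsf{False}\}$. Define $\mathsf k()=\max(\{-1\}\cup\{x\in S(n-1): S(x)\subseteq\mathsf K\})$. - $\mathsf{propose}(v)$: if $v\ne\bot$ and $O=\bot$, then $O.(v,\mathit{proposals},BC,\mathit{txDes},\mathit{oneTerm})\gets(v,[\bot,\dots,\bot],[\bot,\dots,\bot],\bot,\mathsf{False})$. - $\mathsf{result}()$, with $k=\mathsf k()$: if $O=\bot$ return $\bot$; else if $O.v=\bot$ or $k\ge n-1$ return ERR; else if $BC[k+1]=\bot$ or $BC[k+1].\mathsf{result}(k+1)\ne\mathsf{True}$ return $\bot$; else if $O.\mathit{proposals}[k+1]=\bot$ return ERR; else return $O.\mathit{proposals}[k+1]$.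 - *Do forever*, whenever $O\ne\bot$: (1) if $v\ne\bot$ and ($\mathit{txDes}=\bot$ or $\mathsf{hasTerminated}(\mathit{txDes})$), then set $\mathit{oneTerm}\gets\mathit{oneTerm}\vee(\mathit{txDes}\ne\bot\wedge\mathsf{hasTerminated}(\mathit{txDes}))$ and then $\mathit{txDes}\gets\mathsf{urbBroadcast}\ \mathrm{PROPOSAL}(v)$; (2) use one of two variants. *Sequential*: with $k=\mathsf k()$, if $\mathit{oneTerm}$, $k<n-1$, $BC[k+1]=\bot$ and ($k=-1$ or $BC[k].\mathsf{result}(k)\ne\bot$), then call $\mathsf{binPropose}(k+1,\ \mathit{proposals}[k+1]\ne\bot)$. *Concurrent*: if $\mathit{oneTerm}$ and some $BC[\ell]=\bot$, then for each $k\in\{0,\dots,n-1\}$ with $BC[k]=\bot$ call $\mathsf{binPropose}(k,\ \mathit{proposals}[k]\ne\bot)$. - *Upon URB-delivery of* $\mathrm{PROPOSAL}(v_J)$ *from* $p_j$ with $v_J\ne\bot$: if $O\ne\bot$ and $O.\mathit{proposals}[j]=\bot$, then $O.\mathit{proposals}[j]\gets v_J$; else if $O=\bot$, activate $O$ with $O.(v,\mathit{proposals},BC,\mathit{txDes},\mathit{oneTerm})\gets(v_J,[\bot,\dots,\bot],[\bot,\dots,\bot],\bot,\mathsf{False})$ and then $O.\mathit{proposals}[j]\gets v_J$. The statement is for either variant of (2). **Authentic executions.** A system state is *completely free* of PROPOSAL messages if the channels contain no PROPOSAL messages and no non-failing processor has an active object (all $O_i=\bot$). An invocation of $\mathsf{propose}$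 by $p_i$ in which $O_i$ becomes active, taken immediately after a completely free state, is authentic. A PROPOSAL transmission by a processor following its authentic invocation is authentic. An arrival of a PROPOSAL message is authentic if it is due to an authentic transmission. If $p_j$ activates $O_j$ because of an authentic arrival (rather than by a call to $\mathsf{propose}$), this also counts as an authentic invocation by $p_j$. These notions are closed transitively. $R$ is *authentic* if it starts in a completely free state and, for every $p_k\in\mathcal P$, every invocation of $\mathsf{propose}_k$ in $R$ and every transmission and reception of PROPOSAL messages from or to $p_k$ is authentic, i.e., all PROPOSAL activity in $R$ originates from invocations of $\mathsf{propose}$ in $R$ and not from stale initial information. *)

theory Defs
  imports Main "HOL-Library.Multiset"
begin

text \<open>
  Processors are the numbers below \<open>n\<close>; arrays indexed by \<open>0..n-1\<close> are functions on
  \<open>nat\<close> of which only the entries below \<open>n\<close> are used.  \<open>Bot\<close> and \<open>Err\<close> are the two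
  special symbols; proposable values are \<open>Val x\<close> with \<open>x\<close> in the finite set \<open>V\<close>.
\<close>

datatype 'v sym = Bot | Err | Val 'v

text \<open>Local copy of a binary consensus object; \<open>BCBot\<close> means inactive.\<close>

datatype bc = BCBot | BCUndecided | BCDecided bool

fun bc_result :: "bc \<Rightarrow> bool option" where
  "bc_result (BCDecided b) = Some b"
| "bc_result _ = None"

record 'v obj =
  oV :: "'v sym"
  oProposals :: "nat \<Rightarrow> 'v sym"
  oBC :: "nat \<Rightarrow> bc"
  oTxDes :: "nat option"
  oOneTerm :: bool

definition fresh_obj :: "'v sym \<Rightarrow> 'v obj" where
  "fresh_obj v = \<lparr>oV = v, oProposals = (\<lambda>_. Bot), oBC = (\<lambda>_. BCBot),
                  oTxDes = None, oOneTerm = False\<rparr>"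

text \<open>
  A PROPOSAL message, with its sender, the descriptor returned by its \<open>urbBroadcast\<close>, and
  its value.  A packet is what travels on a channel: it either carries a PROPOSAL message
  or belongs to some other traffic (acknowledgements, binary consensus, ...).
\<close>

datatype 'v msg = PROPOSAL (sender: nat) (descr: nat) (mval: "'v sym")

datatype 'v packet = Carrier "'v msg" | Other nat

datatype line = Line1 | Line2

text \<open>
  \<open>objects s i = None\<close> stands for \<open>O\<^sub>i = \<bottom>\<close>.  \<open>pc s i\<close> is the line of the do-forever loop to
  be executed next by \<open>i\<close>.  \<open>terminated s i\<close> is the set of descriptors for which
  \<open>hasTerminated\<close> holds at \<open>i\<close>.  \<open>chan s i j\<close> is the content of the channel from \<open>i\<close> to \<open>j\<close>.
\<close>

record 'v state =
  crashed :: "nat set"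
  objects :: "nat \<Rightarrow> 'v obj option"
  pc :: "nat \<Rightarrow> line"
  terminated :: "nat \<Rightarrow> nat set"
  chan :: "nat \<Rightarrow> nat \<Rightarrow> 'v packet multiset"


subsection \<open>The algorithm\<close>

datatype variant = Sequential | Concurrent

definition Kset :: "nat \<Rightarrow> 'v obj \<Rightarrow> nat set" where
  "Kset n ob = {k. k < n \<and> oBC ob k \<noteq> BCBot \<and> bc_result (oBC ob k) = Some False}"

definition kk :: "nat \<Rightarrow> 'v obj \<Rightarrow> int" where
  "kk n ob = Max ({-1} \<union> int ` {x. x < n \<and> {0..x} \<subseteq> Kset n ob})"

definition propose_eff :: "'v sym \<Rightarrow> 'v obj option \<Rightarrow> 'v obj option" where
  "propose_eff v ob = (if v \<noteq> Bot \<and> ob = None then Some (fresh_obj v) else ob)"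

definition result :: "nat \<Rightarrow> 'v obj option \<Rightarrow> 'v sym" where
  "result n obo = (case obo of None \<Rightarrow> Bot
     | Some ob \<Rightarrow>
        (let k = kk n ob; l = nat (k + 1) in
         if oV ob = Bot \<or> k \<ge> int n - 1 then Err
         else if oBC ob l = BCBot \<or> bc_result (oBC ob l) \<noteq> Some True then Bot
         else if oProposals ob l = Bot then Err
         else oProposals ob l))"

text \<open>Line (1): \<open>term\<close> is the set of locally terminated descriptors, \<open>d\<close> the descriptor
  returned by the call to \<open>urbBroadcast\<close>, if there is one.\<close>

definition has_terminated :: "nat set \<Rightarrow> 'v obj \<Rightarrow> bool" where
  "has_terminated term ob = (\<exists>d. oTxDes ob = Some d \<and> d \<in> term)"

definition line1_guard :: "nat set \<Rightarrow> 'v obj \<Rightarrow> bool" where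
  "line1_guard term ob \<longleftrightarrow> oV ob \<noteq> Bot \<and> (oTxDes ob = None \<or> has_terminated term ob)"

definition line1_eff :: "nat set \<Rightarrow> nat \<Rightarrow> 'v obj \<Rightarrow> 'v obj" where
  "line1_eff term d ob =
     (if line1_guard term ob
      then ob\<lparr>oOneTerm := (oOneTerm ob \<or> (oTxDes ob \<noteq> None \<and> has_terminated term ob)),
              oTxDes := Some d\<rparr>
      else ob)"

text \<open>Line (2): the pairs \<open>(k, b)\<close> for which it calls \<open>binPropose(k, b)\<close>.\<close>

fun bin_calls :: "nat \<Rightarrow> variant \<Rightarrow> 'v obj \<Rightarrow> (nat \<times> bool) set" where
  "bin_calls n Sequential ob =
     (let k = kk n ob; l = nat (k + 1) in
      if oOneTerm ob \<and> k < int n - 1 \<and> oBC ob l = BCBot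
           \<and> (k = -1 \<or> bc_result (oBC ob (nat k)) \<noteq> None)
      then {(l, oProposals ob l \<noteq> Bot)} else {})"
| "bin_calls n Concurrent ob =
     (if oOneTerm ob \<and> (\<exists>l<n. oBC ob l = BCBot)
      then {(k, oProposals ob k \<noteq> Bot) | k. k < n \<and> oBC ob k = BCBot} else {})"

definition line2_eff :: "nat \<Rightarrow> variant \<Rightarrow> 'v obj \<Rightarrow> 'v obj" where
  "line2_eff n var ob =
     ob\<lparr>oBC := (\<lambda>k. if k \<in> fst ` bin_calls n var ob then BCUndecided else oBC ob k)\<rparr>"

definition deliver_eff :: "'v msg \<Rightarrow> 'v obj option \<Rightarrow> 'v obj option" where
  "deliver_eff m obo =
     (let j = sender m; vJ = mval m;
          store = (\<lambda>ob. ob\<lparr>oProposals := (oProposals ob)(j := vJ)\<rparr>) in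
      if vJ = Bot then obo
      else (case obo of
              Some ob \<Rightarrow> if oProposals ob j = Bot then Some (store ob) else Some ob
            | None \<Rightarrow> Some (store (fresh_obj vJ))))"


subsection \<open>Steps and executions\<close>

text \<open>
  \<open>Loop1 i d\<close>, \<open>Loop2 i\<close>: processor \<open>i\<close> executes line (1) or (2) of its loop.
  \<open>Deliver i m\<close>: \<open>i\<close> URB-delivers \<open>m\<close>.  \<open>BCDecide i k b\<close>: the local copy at \<open>i\<close> of the
  \<open>k\<close>-th binary consensus object decides \<open>b\<close>.  \<open>UrbInfo i\<close>: the URB layer of \<open>i\<close> changes
  the value of \<open>hasTerminated\<close>.  \<open>Send i j p\<close>: \<open>i\<close> sends \<open>p\<close> on its channel to \<open>j\<close>.
  \<open>Recv i j p\<close>: \<open>j\<close> receives \<open>p\<close> from that channel.  \<open>Fault i j p\<close>: the channel omits or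
  duplicates \<open>p\<close>.
\<close>

datatype 'v action =
    Propose nat "'v sym"
  | Loop1 nat nat
  | Loop2 nat
  | Deliver nat "'v msg"
  | BCDecide nat nat bool
  | UrbInfo nat
  | Crash nat
  | Send nat nat "'v packet"
  | Recv nat nat "'v packet"
  | Fault nat nat "'v packet"

definition alive :: "nat \<Rightarrow> 'v state \<Rightarrow> nat \<Rightarrow> bool" where
  "alive n s i \<longleftrightarrow> i < n \<and> i \<notin> crashed s"

definition set_obj :: "nat \<Rightarrow> 'v obj option \<Rightarrow> 'v state \<Rightarrow> 'v state" where
  "set_obj i ob s = s\<lparr>objects := (objects s)(i := ob)\<rparr>"

definition set_pc :: "nat \<Rightarrow> line \<Rightarrow> 'v state \<Rightarrow> 'v state" where
  "set_pc i l s = s\<lparr>pc := (pc s)(i := l)\<rparr>"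

definition set_chan :: "nat \<Rightarrow> nat \<Rightarrow> 'v packet multiset \<Rightarrow> 'v state \<Rightarrow> 'v state" where
  "set_chan i j c s = s\<lparr>chan := (chan s)(i := (chan s i)(j := c))\<rparr>"

text \<open>Channels are multisets, so they do not preserve order; a packet being sent may enter
  its channel any number of times, including none.  An iteration of the loop is skipped
  while the object is inactive.\<close>

fun step :: "nat \<Rightarrow> 'v set \<Rightarrow> variant \<Rightarrow> 'v state \<Rightarrow> 'v action \<Rightarrow> 'v state \<Rightarrow> bool" where
  "step n V var s (Propose i v) s' \<longleftrightarrow>
     alive n s i \<and> v \<in> {Bot} \<union> Val ` V \<and> s' = set_obj i (propose_eff v (objects s i)) s"
| "step n V var s (Loop1 i d) s' \<longleftrightarrow>
     alive n s i \<and> pc s i = Line1 \<and>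
     s' = (case objects s i of None \<Rightarrow> s
           | Some ob \<Rightarrow> set_pc i Line2 (set_obj i (Some (line1_eff (terminated s i) d ob)) s))"
| "step n V var s (Loop2 i) s' \<longleftrightarrow>
     alive n s i \<and> pc s i = Line2 \<and>
     s' = set_pc i Line1 (set_obj i (map_option (line2_eff n var) (objects s i)) s)"
| "step n V var s (Deliver i m) s' \<longleftrightarrow>
     alive n s i \<and> sender m < n \<and> s' = set_obj i (deliver_eff m (objects s i)) s"
| "step n V var s (BCDecide i k b) s' \<longleftrightarrow>
     alive n s i \<and> k < n \<and>
     (\<exists>ob. objects s i = Some ob \<and> oBC ob k \<noteq> BCBot \<and>
           s' = set_obj i (Some (ob\<lparr>oBC := (oBC ob)(k := BCDecided b)\<rparr>)) s)"
| "step n V var s (UrbInfo i) s' \<longleftrightarrow>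
     alive n s i \<and> (\<exists>T. s' = s\<lparr>terminated := (terminated s)(i := T)\<rparr>)"
| "step n V var s (Crash i) s' \<longleftrightarrow>
     alive n s i \<and> s' = s\<lparr>crashed := insert i (crashed s)\<rparr>"
| "step n V var s (Send i j p) s' \<longleftrightarrow>
     alive n s i \<and> j < n \<and> (\<exists>r. s' = set_chan i j (chan s i j + replicate_mset r p) s)"
| "step n V var s (Recv i j p) s' \<longleftrightarrow>
     alive n s j \<and> i < n \<and> p \<in># chan s i j \<and> s' = set_chan i j (chan s i j - {#p#}) s"
| "step n V var s (Fault i j p) s' \<longleftrightarrow>
     i < n \<and> j < n \<and> p \<in># chan s i j \<and>
     (\<exists>r. s' = set_chan i j ({#q \<in># chan s i j. q \<noteq> p#} + replicate_mset r p) s)"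

text \<open>The alternating sequence of states \<open>st R 0, st R 1, ...\<close> and steps, where \<open>act R m\<close>
  leads from \<open>st R m\<close> to \<open>st R (Suc m)\<close>.\<close>

record 'v run =
  st :: "nat \<Rightarrow> 'v state"
  act :: "nat \<Rightarrow> 'v action"

definition Correct :: "nat \<Rightarrow> 'v run \<Rightarrow> nat set" where
  "Correct n R = {i. i < n \<and> (\<forall>m. i \<notin> crashed (st R m))}"

definition fair_communication :: "nat \<Rightarrow> 'v run \<Rightarrow> bool" where
  "fair_communication n R \<longleftrightarrow>
     (\<forall>i<n. \<forall>j\<in>Correct n R. \<forall>p.
        infinite {m. act R m = Send i j p} \<longrightarrow> infinite {m. act R m = Recv i j p})"

text \<open>The last conjunct says that a correct processor executes its loop forever.\<close>

definition execution ::
  "nat \<Rightarrow> nat \<Rightarrow> nat \<Rightarrow> 'v set \<Rightarrow> variant \<Rightarrow> 'v run \<Rightarrow> bool" where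
  "execution n t cap V var R \<longleftrightarrow>
     (\<forall>m. step n V var (st R m) (act R m) (st R (Suc m))) \<and>
     card ({..<n} - Correct n R) \<le> t \<and>
     (\<forall>m. \<forall>i<n. \<forall>j<n. size (chan (st R m) i j) \<le> cap) \<and>
     fair_communication n R \<and>
     (\<forall>i\<in>Correct n R. infinite {m. act R m = Loop2 i \<or> (\<exists>d. act R m = Loop1 i d)})"


subsection \<open>Uniform reliable broadcast\<close>

definition urb_broadcasts :: "'v run \<Rightarrow> nat \<Rightarrow> 'v msg \<Rightarrow> bool" where
  "urb_broadcasts R m msg \<longleftrightarrow>
     (\<exists>ob. act R m = Loop1 (sender msg) (descr msg) \<and>
           objects (st R m) (sender msg) = Some ob \<and>
           line1_guard (terminated (st R m) (sender msg)) ob \<and> mval msg = oV ob)"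

definition urb_delivers :: "'v run \<Rightarrow> nat \<Rightarrow> nat \<Rightarrow> 'v msg \<Rightarrow> bool" where
  "urb_delivers R m j msg \<longleftrightarrow> act R m = Deliver j msg"

definition urb_unique_descriptors :: "'v run \<Rightarrow> bool" where
  "urb_unique_descriptors R \<longleftrightarrow>
     (\<forall>m m' msg msg'. urb_broadcasts R m msg \<and> urb_broadcasts R m' msg' \<and>
        sender msg = sender msg' \<and> descr msg = descr msg' \<longrightarrow> m = m')"

text \<open>A message that is already in a channel in the first state of \<open>R\<close> may have been sent
  before \<open>R\<close> starts.\<close>

definition urb_validity :: "nat \<Rightarrow> 'v run \<Rightarrow> bool" where
  "urb_validity n R \<longleftrightarrow>
     (\<forall>m j msg. urb_delivers R m j msg \<longrightarrow>
        (\<exists>m'<m. urb_broadcasts R m' msg) \<or>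
        (\<exists>i<n. \<exists>k<n. Carrier msg \<in># chan (st R 0) i k))"

definition urb_integrity :: "'v run \<Rightarrow> bool" where
  "urb_integrity R \<longleftrightarrow>
     (\<forall>m m' j msg. urb_delivers R m j msg \<and> urb_delivers R m' j msg \<longrightarrow> m = m')"

definition urb_termination :: "nat \<Rightarrow> 'v run \<Rightarrow> bool" where
  "urb_termination n R \<longleftrightarrow>
     (\<forall>msg. ((\<exists>m. urb_broadcasts R m msg) \<and> sender msg \<in> Correct n R) \<or>
            (\<exists>m j. urb_delivers R m j msg) \<longrightarrow>
        (\<forall>k\<in>Correct n R. \<exists>m. urb_delivers R m k msg))"

text \<open>When \<open>hasTerminated\<close> holds in a state, the message has been delivered by every
  processor that has not failed in that state (and not merely by those that never
  fail).  At a correct sender it eventually holds, and then keeps holding.\<close>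

definition has_terminated_sound :: "nat \<Rightarrow> 'v run \<Rightarrow> bool" where
  "has_terminated_sound n R \<longleftrightarrow>
     (\<forall>m m' msg. urb_broadcasts R m msg \<and> m < m' \<and>
        descr msg \<in> terminated (st R m') (sender msg) \<longrightarrow>
        (\<forall>k. alive n (st R m') k \<longrightarrow> (\<exists>m''<m'. urb_delivers R m'' k msg)))"

definition has_terminated_live :: "nat \<Rightarrow> 'v run \<Rightarrow> bool" where
  "has_terminated_live n R \<longleftrightarrow>
     (\<forall>m msg. urb_broadcasts R m msg \<and> sender msg \<in> Correct n R \<longrightarrow>
        (\<exists>m'. \<forall>m''\<ge>m'. descr msg \<in> terminated (st R m'') (sender msg)))"

definition urb_spec :: "nat \<Rightarrow> 'v run \<Rightarrow> bool" where
  "urb_spec n R \<longleftrightarrow> urb_unique_descriptors R \<and> urb_validity n R \<and> urb_integrity R \<and>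
     urb_termination n R \<and> has_terminated_sound n R \<and> has_terminated_live n R"


subsection \<open>Binary consensus\<close>

definition bin_proposes :: "nat \<Rightarrow> variant \<Rightarrow> 'v run \<Rightarrow> nat \<Rightarrow> nat \<Rightarrow> nat \<Rightarrow> bool \<Rightarrow> bool" where
  "bin_proposes n var R m j k b \<longleftrightarrow>
     act R m = Loop2 j \<and>
     (\<exists>ob. objects (st R m) j = Some ob \<and> (k, b) \<in> bin_calls n var ob)"

definition bc_validity :: "nat \<Rightarrow> variant \<Rightarrow> 'v run \<Rightarrow> bool" where
  "bc_validity n var R \<longleftrightarrow>
     (\<forall>m i k b. act R m = BCDecide i k b \<longrightarrow> (\<exists>m'<m. \<exists>j<n. bin_proposes n var R m' j k b))"

definition bc_agreement :: "'v run \<Rightarrow> bool" where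
  "bc_agreement R \<longleftrightarrow>
     (\<forall>m m' i i' k b b'. act R m = BCDecide i k b \<and> act R m' = BCDecide i' k b' \<longrightarrow> b = b')"

definition bc_integrity :: "'v run \<Rightarrow> bool" where
  "bc_integrity R \<longleftrightarrow>
     (\<forall>m m' i k b b'. act R m = BCDecide i k b \<and> act R m' = BCDecide i k b' \<longrightarrow> m = m')"

definition bc_termination :: "nat \<Rightarrow> 'v run \<Rightarrow> bool" where
  "bc_termination n R \<longleftrightarrow>
     (\<forall>i\<in>Correct n R. \<forall>k<n. \<forall>m ob.
        objects (st R m) i = Some ob \<and> oBC ob k \<noteq> BCBot \<longrightarrow>
        (\<exists>m'\<ge>m. \<exists>ob'. objects (st R m') i = Some ob' \<and> bc_result (oBC ob' k) \<noteq> None))"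

definition bc_spec :: "nat \<Rightarrow> variant \<Rightarrow> 'v run \<Rightarrow> bool" where
  "bc_spec n var R \<longleftrightarrow>
     bc_validity n var R \<and> bc_agreement R \<and> bc_integrity R \<and> bc_termination n R"

definition bin_invocations :: "nat \<Rightarrow> variant \<Rightarrow> 'v run \<Rightarrow> nat \<Rightarrow> (nat \<times> nat) set" where
  "bin_invocations n var R j = {(m, k). \<exists>b. bin_proposes n var R m j k b}"


subsection \<open>Authentic executions\<close>

definition completely_free :: "nat \<Rightarrow> 'v state \<Rightarrow> bool" where
  "completely_free n s \<longleftrightarrow>
     (\<forall>i<n. \<forall>j<n. \<forall>msg. Carrier msg \<notin># chan s i j) \<and>
     (\<forall>i. alive n s i \<longrightarrow> objects s i = None)"

definition activates :: "'v run \<Rightarrow> nat \<Rightarrow> nat \<Rightarrow> bool" where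
  "activates R m i \<longleftrightarrow> objects (st R m) i = None \<and> objects (st R (Suc m)) i \<noteq> None"

text \<open>
  The index \<open>m\<close> is that of the step in which the invocation, transmission or arrival takes
  place.  Several processors may call \<open>propose\<close> independently of each other; hence in
  \<open>call\<close> the completely free state need not be the one right before the call.
\<close>

inductive auth_inv :: "nat \<Rightarrow> 'v run \<Rightarrow> nat \<Rightarrow> nat \<Rightarrow> bool"
  and auth_tx :: "nat \<Rightarrow> 'v run \<Rightarrow> nat \<Rightarrow> 'v msg \<Rightarrow> bool"
  and auth_rx :: "nat \<Rightarrow> 'v run \<Rightarrow> nat \<Rightarrow> nat \<Rightarrow> 'v msg \<Rightarrow> bool"
  for n :: nat and R :: "'v run"
where
  call: "completely_free n (st R m0) \<Longrightarrow> m0 \<le> m \<Longrightarrow> act R m = Propose i v \<Longrightarrow>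
     activates R m i \<Longrightarrow> auth_inv n R m i"
| transmission: "auth_inv n R m (sender msg) \<Longrightarrow> m < m' \<Longrightarrow> urb_broadcasts R m' msg \<Longrightarrow>
     auth_tx n R m' msg"
| arrival: "auth_tx n R m msg \<Longrightarrow> m < m' \<Longrightarrow> urb_delivers R m' j msg \<Longrightarrow>
     auth_rx n R m' j msg"
| activation: "auth_rx n R m j msg \<Longrightarrow> activates R m j \<Longrightarrow> auth_inv n R m j"

text \<open>Calls to \<open>propose\<close> that leave the object unchanged cause no PROPOSAL activity and are
  not restricted.  The last conjunct is about the packets underlying URB.\<close>

definition authentic :: "nat \<Rightarrow> 'v run \<Rightarrow> bool" where
  "authentic n R \<longleftrightarrow>
     completely_free n (st R 0) \<and>
     (\<forall>m. \<forall>k<n. activates R m k \<longrightarrow> auth_inv n R m k) \<and>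
     (\<forall>m msg. urb_broadcasts R m msg \<longrightarrow> auth_tx n R m msg) \<and>
     (\<forall>m j msg. urb_delivers R m j msg \<longrightarrow> auth_rx n R m j msg) \<and>
     (\<forall>m i j msg. act R m = Send i j (Carrier msg) \<or> act R m = Recv i j (Carrier msg) \<longrightarrow>
        (\<exists>m'<m. auth_tx n R m' msg))"

text \<open>A processor proposes a value either by calling \<open>propose\<close> or, since this counts as an
  invocation by it, by being activated by an authentic arrival.\<close>

definition proposes_value :: "nat \<Rightarrow> 'v set \<Rightarrow> 'v run \<Rightarrow> nat \<Rightarrow> bool" where
  "proposes_value n V R j \<longleftrightarrow>
     (\<exists>m. (\<exists>v\<in>V. act R m = Propose j (Val v)) \<or>
          (\<exists>msg. auth_rx n R m j msg \<and> activates R m j))"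

definition first_propose :: "'v run \<Rightarrow> nat \<Rightarrow> nat \<Rightarrow> 'v sym \<Rightarrow> bool" where
  "first_propose R a i v \<longleftrightarrow>
     act R a = Propose i v \<and> (\<forall>m<a. \<forall>j w. act R m \<noteq> Propose j w)"

end

theory Submission imports Defs "HOL-Library.Infinite_Set" begin

text \<open>
  When \<open>oneTerm\<close> becomes true at \<open>p\<^sub>j\<close>, every processor that has not failed by then has stored
  the proposal of \<open>p\<^sub>j\<close>.  Apply this to the processor \<open>p\<^sub>j\<close> that makes the first invocation of
  \<open>binPropose\<close> in the run: all invocations on \<open>BC[j]\<close> propose \<open>True\<close>, so \<open>BC[j]\<close> never decides
  \<open>False\<close>.  Let \<open>l\<close> be the least index for which \<open>BC[l]\<close> never decides \<open>False\<close>.  At every correct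
  processor \<open>BC[0], \<dots>, BC[l]\<close> are eventually activated and decide; the last one decides
  \<open>True\<close>, so some processor had stored a proposal of \<open>p\<^sub>l\<close>, and URB-termination brings it to every
  correct processor.  All messages of \<open>p\<^sub>l\<close> carry the same value, so that value is the result.
\<close>

section \<open>The threshold index\<close>

text \<open>The initial segments contained in \<open>Kset n ob\<close> are exactly those that end
  below \<open>l\<close>; for \<open>l = 0\<close> there are none and the default \<open>-1\<close>
  is the maximum.\<close>

lemma kk_eqI:
  assumes "\<And>y. y < l \<Longrightarrow> y \<in> Kset n ob" and "l \<notin> Kset n ob"
  shows "kk n ob = int l - 1"
proof -
  let ?A = "{-1} \<union> int ` {x. x < n \<and> {0..x} \<subseteq> Kset n ob}"
  have "int x \<le> int l - 1" if "{0..x} \<subseteq> Kset n ob" for x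
    using that assms(2) by (cases "l \<le> x") auto
  moreover have "int l - 1 \<in> ?A"
  proof (cases l)
    case (Suc y)
    moreover have "y < n" using assms(1)[of y] Suc by (simp add: Kset_def)
    moreover have "{0..y} \<subseteq> Kset n ob" using assms(1) Suc by auto
    ultimately show ?thesis by auto
  qed simp
  ultimately show ?thesis unfolding kk_def by (intro Max_eqI) auto
qed

lemma kk_ge: "kk n ob \<ge> -1"
  unfolding kk_def by (rule Max_ge) auto

text \<open>What a call guarantees in either variant, so that later arguments about calls need not
  distinguish them.\<close>

lemma bin_callsD:
  assumes "(k, b) \<in> bin_calls n var ob"
  shows "k < n" "oBC ob k = BCBot" "oOneTerm ob" "b \<longleftrightarrow> oProposals ob k \<noteq> Bot"
  using assms kk_ge[of n ob] by (cases var; auto simp: Let_def split: if_splits)+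

lemma bin_calls_next:
  assumes "oOneTerm ob" "l < n" "oBC ob l = BCBot"
    and "\<And>y. y < l \<Longrightarrow> oBC ob y = BCDecided False"
  shows "l \<in> fst ` bin_calls n var ob"
proof (cases var)
  case Sequential
  have "kk n ob = int l - 1"
    using assms by (intro kk_eqI) (auto simp: Kset_def)
  \<comment> \<open>The sequential guard asks for a decision of the preceding object; for
    \<open>l = 0\<close> it is met because \<open>kk n ob = -1\<close>.\<close>
  moreover have "bc_result (oBC ob (l - 1)) \<noteq> None" if "l \<noteq> 0"
    using assms(4)[of "l - 1"] that by simp
  ultimately show ?thesis
    using assms Sequential by (cases "l = 0") (auto simp: nat_diff_distrib')
next
  case Concurrent
  then show ?thesis using assms by (force simp: image_iff)
qed

section \<open>Steps and local objects\<close>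

text \<open>Only actions of \<open>i\<close> itself touch its object. Since the object really
  changes, calls, deliveries and executions of line (1) without effect drop out of the case
  split.\<close>

lemma step_object_cases:
  assumes "step n V var s e s'" and "objects s' i \<noteq> objects s i"
  obtains (Propose) v where "e = Propose i v" "v \<in> Val ` V" "objects s i = None"
      "objects s' i = Some (fresh_obj v)"
  | (Loop1) d ob where "e = Loop1 i d" "objects s i = Some ob"
      "line1_guard (terminated s i) ob"
      "objects s' i = Some (line1_eff (terminated s i) d ob)"
  | (Loop2) ob where "e = Loop2 i" "objects s i = Some ob"
      "objects s' i = Some (line2_eff n var ob)"
  | (Deliver) m where "e = Deliver i m" "mval m \<noteq> Bot"
      "objects s' i = deliver_eff m (objects s i)"
  | (BCDecide) k b ob where "e = BCDecide i k b" "objects s i = Some ob" "oBC ob k \<noteq> BCBot"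
      "objects s' i = Some (ob\<lparr>oBC := (oBC ob)(k := BCDecided b)\<rparr>)"
  using assms
  by (cases e)
     (force simp: set_obj_def set_pc_def set_chan_def propose_eff_def deliver_eff_def line1_eff_def
        Let_def split: if_splits option.splits)+

text \<open>A decision may still be overwritten here; that it is not follows from \<open>bc_agreement\<close>.\<close>

definition obj_le :: "'v obj \<Rightarrow> 'v obj \<Rightarrow> bool" where
  "obj_le ob ob' \<longleftrightarrow> oV ob' = oV ob \<and> (oOneTerm ob \<longrightarrow> oOneTerm ob') \<and>
     (\<forall>j. oProposals ob j \<noteq> Bot \<longrightarrow> oProposals ob' j = oProposals ob j) \<and>
     (\<forall>k. oBC ob k \<noteq> BCBot \<longrightarrow> oBC ob' k \<noteq> BCBot) \<and>
     (\<forall>k. bc_result (oBC ob k) \<noteq> None \<longrightarrow> bc_result (oBC ob' k) \<noteq> None)"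

lemma obj_le_refl: "obj_le ob ob"
  by (simp add: obj_le_def)

lemma obj_le_trans: "obj_le a b \<Longrightarrow> obj_le b c \<Longrightarrow> obj_le a c"
  unfolding obj_le_def by metis

lemma step_obj_le:
  assumes "step n V var s e s'" and ob: "objects s i = Some ob"
  shows "\<exists>ob'. objects s' i = Some ob' \<and> obj_le ob ob'"
proof (cases "objects s' i = objects s i")
  case True
  then show ?thesis using ob by (simp add: obj_le_refl)
next
  case False
  from assms(1) False show ?thesis
  proof (cases rule: step_object_cases)
    case Loop1
    then show ?thesis using ob by (simp add: obj_le_def line1_eff_def)
  next
    case Loop2
    \<comment> \<open>Calls go only to inactive entries, so setting these to undecided erases no
      decision.\<close>
    have "oBC ob k = BCBot" if "k \<in> fst ` bin_calls n var ob" for k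
      using that by (auto dest: bin_callsD)
    then show ?thesis using Loop2 ob by (auto simp: obj_le_def line2_eff_def)
  next
    case Deliver
    then show ?thesis using ob by (auto simp: obj_le_def deliver_eff_def Let_def)
  qed (use ob in \<open>auto simp: obj_le_def\<close>)
qed

lemma step_pc_cases:
  assumes "step n V var s e s'" and "pc s' i \<noteq> pc s i"
  shows "e = Loop2 i \<and> pc s' i = Line1 \<or> (\<exists>d. e = Loop1 i d \<and> pc s' i = Line2)"
  using assms
  by (cases e) (auto simp: set_obj_def set_pc_def set_chan_def split: if_splits option.splits)

lemma step_crashed: "step n V var s e s' \<Longrightarrow> crashed s \<subseteq> crashed s'"
  by (cases e) (auto simp: set_obj_def set_pc_def set_chan_def split: option.splits)

section \<open>Authentic runs\<close>

locale authentic_run =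
  fixes n t cap :: nat and V :: "'v set" and var :: variant and R :: "'v run"
  assumes few_crashes: "2 * t < n"
    and exec: "execution n t cap V var R"
    and urb: "urb_spec n R"
    and bc: "bc_spec n var R"
    and auth: "authentic n R"
    and proposals: "\<forall>j\<in>Correct n R. proposes_value n V R j"
begin

abbreviation obj :: "nat \<Rightarrow> nat \<Rightarrow> 'v obj option" where
  "obj m i \<equiv> objects (st R m) i"

section \<open>Persistence and induction along the run\<close>

lemma run_step: "step n V var (st R m) (act R m) (st R (Suc m))"
  using exec by (simp add: execution_def)

lemma crashed_mono: "m \<le> m' \<Longrightarrow> crashed (st R m) \<subseteq> crashed (st R m')"
  by (rule lift_Suc_mono_le[where f = "\<lambda>m. crashed (st R m)"]) (rule step_crashed[OF run_step])

lemma alive_antimono: "alive n (st R m') i \<Longrightarrow> m \<le> m' \<Longrightarrow> alive n (st R m) i"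
  using crashed_mono unfolding alive_def by blast

lemma Correct_alive: "i \<in> Correct n R \<Longrightarrow> alive n (st R m) i"
  by (simp add: Correct_def alive_def)

lemma obj_mono:
  assumes "obj m i = Some ob" "m \<le> m'"
  obtains ob' where "obj m' i = Some ob'" "obj_le ob ob'"
proof -
  have "\<exists>ob'. obj m' i = Some ob' \<and> obj_le ob ob'"
    using assms(2)
  proof (induction rule: dec_induct)
    case base
    then show ?case using assms(1) obj_le_refl by blast
  next
    case (step m')
    then show ?case using step_obj_le[OF run_step] obj_le_trans by blast
  qed
  then show ?thesis using that by blast
qed

lemma obj_leI: "obj m i = Some ob \<Longrightarrow> obj m' i = Some ob' \<Longrightarrow> m \<le> m' \<Longrightarrow> obj_le ob ob'"
  by (metis obj_mono option.inject)

lemma obj_None_init: "alive n (st R m) i \<Longrightarrow> obj 0 i = None"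
  using auth alive_antimono[of m i 0] by (simp add: authentic_def completely_free_def)

text \<open>Invariants of one object start at its activation, since the first state is completely
  free. The case \<open>change\<close> keeps the inequality so that \<open>step_object_cases\<close>
  applies.\<close>

lemma obj_induct [consumes 2, case_names fresh same change]:
  assumes "alive n (st R 0) i" "obj m i = Some ob"
    and fresh: "\<And>m ob. obj m i = None \<Longrightarrow> obj (Suc m) i = Some ob \<Longrightarrow> P (Suc m) ob"
    and same: "\<And>m ob. obj m i = Some ob \<Longrightarrow> obj (Suc m) i = Some ob \<Longrightarrow> P m ob \<Longrightarrow> P (Suc m) ob"
    and change: "\<And>m ob ob'. obj m i = Some ob \<Longrightarrow> obj (Suc m) i = Some ob' \<Longrightarrow>
      obj (Suc m) i \<noteq> obj m i \<Longrightarrow> P m ob \<Longrightarrow> P (Suc m) ob'"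
  shows "P m ob"
  using assms(2)
proof (induction m arbitrary: ob)
  case 0
  then show ?case using obj_None_init[OF assms(1)] by simp
next
  case (Suc m)
  show ?case
  proof (cases "obj m i")
    case None
    then show ?thesis using fresh Suc.prems by blast
  next
    case (Some ob')
    then show ?thesis using same change Suc by (cases "obj (Suc m) i = obj m i") auto
  qed
qed

subsection \<open>Messages\<close>

text \<open>URB-validity also admits messages that are in a channel at the start; the completely
  free first state has none.\<close>

lemma Deliver_broadcast:
  assumes "act R m = Deliver j msg"
  shows "\<exists>m'<m. urb_broadcasts R m' msg"
proof -
  have "\<forall>i<n. \<forall>k<n. Carrier msg \<notin># chan (st R 0) i k"
    using auth by (simp add: authentic_def completely_free_def)
  moreover have "urb_validity n R" using urb by (simp add: urb_spec_def)
  ultimately show ?thesis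
    using assms unfolding urb_validity_def urb_delivers_def by blast
qed

lemma broadcast_alive: "urb_broadcasts R m msg \<Longrightarrow> alive n (st R 0) (sender msg)"
  using run_step[of m] alive_antimono by (auto simp: urb_broadcasts_def)

text \<open>A delivery may activate an object with the value of the sender, which was broadcast
  strictly earlier; hence the strong induction on time over all processors at once.\<close>

lemma oV_proper:
  assumes "alive n (st R 0) i" "obj m i = Some ob"
  shows "oV ob \<in> Val ` V"
  using assms
proof (induction m arbitrary: i ob rule: less_induct)
  case (less m)
  from less.prems(1) obj_None_init have "obj 0 i = None" by blast
  with less.prems obtain m0 where m: "m = Suc m0" by (cases m) auto
  show ?case
  proof (cases "obj m0 i")
    case (Some ob0)
    then have "oV ob = oV ob0"
      using obj_leI[of m0 i ob0 m ob] less.prems m by (simp add: obj_le_def)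
    then show ?thesis using less.IH[of m0 i ob0] less.prems Some m by simp
  next
    case None
    with less.prems m have "obj (Suc m0) i \<noteq> obj m0 i" by simp
    with run_step show ?thesis
    proof (cases rule: step_object_cases)
      case (Propose v)
      then show ?thesis using less.prems m by (auto simp: fresh_obj_def)
    next
      case (Deliver msg)
      then obtain m' where m': "m' < m0" "urb_broadcasts R m' msg"
        using Deliver_broadcast by blast
      then obtain ob' where "obj m' (sender msg) = Some ob'" "mval msg = oV ob'"
        by (auto simp: urb_broadcasts_def)
      then have "mval msg \<in> Val ` V"
        using less.IH[of m'] broadcast_alive[OF m'(2)] m' m by simp
      then show ?thesis
        using Deliver None less.prems m by (auto simp: deliver_eff_def Let_def fresh_obj_def)
    qed (use None in auto)
  qed
qed

lemma broadcast_proper: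
  assumes "urb_broadcasts R m msg"
  shows "mval msg \<in> Val ` V"
proof -
  obtain ob where "obj m (sender msg) = Some ob" "mval msg = oV ob"
    using assms by (auto simp: urb_broadcasts_def)
  then show ?thesis using oV_proper[OF broadcast_alive[OF assms]] by simp
qed

text \<open>\<open>oV\<close> is fixed at activation, so repeated broadcasts with different
  descriptors carry the same value.\<close>

lemma broadcast_unique_value:
  assumes "urb_broadcasts R m msg" "urb_broadcasts R m' msg'" "sender msg = sender msg'"
  shows "mval msg = mval msg'"
proof -
  obtain ob where ob: "obj m (sender msg) = Some ob" "mval msg = oV ob"
    using assms(1) by (auto simp: urb_broadcasts_def)
  obtain ob' where ob': "obj m' (sender msg') = Some ob'" "mval msg' = oV ob'"
    using assms(2) by (auto simp: urb_broadcasts_def)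
  have "oV ob = oV ob'"
  proof (cases m m' rule: le_cases)
    case le
    then show ?thesis using obj_leI[of m "sender msg" ob m' ob'] ob ob' assms(3) by (simp add: obj_le_def)
  next
    case ge
    then show ?thesis using obj_leI[of m' "sender msg" ob' m ob] ob ob' assms(3) by (simp add: obj_le_def)
  qed
  then show ?thesis using ob ob' by simp
qed

lemma stored_mono:
  assumes "\<exists>ob. obj m k = Some ob \<and> oProposals ob i \<noteq> Bot" "m \<le> m'"
  shows "\<exists>ob. obj m' k = Some ob \<and> oProposals ob i \<noteq> Bot"
proof -
  obtain ob where ob: "obj m k = Some ob" "oProposals ob i \<noteq> Bot" using assms(1) by blast
  obtain ob' where "obj m' k = Some ob'" "obj_le ob ob'" using obj_mono[OF ob(1) assms(2)] .
  then show ?thesis using ob(2) by (auto simp: obj_le_def)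
qed

text \<open>Delivered values are not \<open>Bot\<close>, so the delivery fills the entry unless it
  is filled already, and entries are never erased.\<close>

lemma delivered_stored:
  assumes "act R m = Deliver j msg" "m < m'"
  shows "\<exists>ob. obj m' j = Some ob \<and> oProposals ob (sender msg) \<noteq> Bot"
proof -
  have "mval msg \<noteq> Bot" using Deliver_broadcast[OF assms(1)] broadcast_proper by fastforce
  then have "\<exists>ob. obj (Suc m) j = Some ob \<and> oProposals ob (sender msg) \<noteq> Bot"
    using run_step[of m] assms(1)
    by (auto simp: set_obj_def deliver_eff_def Let_def split: option.splits)
  then show ?thesis using stored_mono assms(2) Suc_leI by blast
qed

lemma stored_delivered:
  assumes "alive n (st R 0) i" "obj m i = Some ob" "oProposals ob j \<noteq> Bot"
  shows "\<exists>m'<m. \<exists>msg. act R m' = Deliver i msg \<and> sender msg = j \<and> mval msg = oProposals ob j"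
  using assms
proof (induction rule: obj_induct)
  case (fresh m ob)
  then have "obj (Suc m) i \<noteq> obj m i" by simp
  with run_step show ?case
    by (cases rule: step_object_cases)
       (use fresh in \<open>auto simp: fresh_obj_def deliver_eff_def Let_def split: if_splits\<close>)
next
  case (change m ob ob')
  from run_step change(3) show ?case
  proof (cases rule: step_object_cases)
    case (Deliver msg)
    then show ?thesis using change
      by (auto simp: deliver_eff_def Let_def split: if_splits intro: less_SucI)
  qed (use change in \<open>auto simp: line1_eff_def line2_eff_def intro: less_SucI split: if_splits\<close>)
qed (auto intro: less_SucI)

text \<open>Different processors may have stored different messages of \<open>j\<close>, but all
  messages of \<open>j\<close> carry one value.\<close>

lemma stored_unique_value:
  assumes "alive n (st R 0) i" "obj m i = Some ob" "oProposals ob j \<noteq> Bot"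
    and "alive n (st R 0) i'" "obj m' i' = Some ob'" "oProposals ob' j \<noteq> Bot"
  shows "oProposals ob j = oProposals ob' j" "oProposals ob j \<in> Val ` V"
proof -
  obtain m1 msg1 where "act R m1 = Deliver i msg1" "sender msg1 = j" "mval msg1 = oProposals ob j"
    using stored_delivered assms by blast
  moreover obtain m2 msg2 where
    "act R m2 = Deliver i' msg2" "sender msg2 = j" "mval msg2 = oProposals ob' j"
    using stored_delivered assms by blast
  ultimately show "oProposals ob j = oProposals ob' j" "oProposals ob j \<in> Val ` V"
    using Deliver_broadcast broadcast_unique_value broadcast_proper by metis+
qed

text \<open>Ties the local descriptor to an actual broadcast, to which the guarantees on
  \<open>terminated\<close> apply.\<close>

lemma txDes_broadcast:
  assumes "alive n (st R 0) i" "obj m i = Some ob" "oTxDes ob = Some d"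
  shows "\<exists>m'<m. urb_broadcasts R m' (PROPOSAL i d (oV ob))"
  using assms
proof (induction rule: obj_induct)
  case (fresh m ob)
  then have "obj (Suc m) i \<noteq> obj m i" by simp
  with run_step show ?case
    by (cases rule: step_object_cases)
       (use fresh in \<open>auto simp: fresh_obj_def deliver_eff_def Let_def split: if_splits\<close>)
next
  case (change m ob ob')
  from run_step change(3) show ?case
  proof (cases rule: step_object_cases)
    case (Loop1 d' ob0)
    then have "urb_broadcasts R m (PROPOSAL i d (oV ob'))"
      using change by (auto simp: urb_broadcasts_def line1_eff_def)
    then show ?thesis by blast
  qed (use change in \<open>auto simp: deliver_eff_def Let_def line2_eff_def intro: less_SucI
        split: if_splits\<close>)
qed (auto intro: less_SucI)

text \<open>The flag is raised only by line (1), when the descriptor of an earlier broadcast of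
  \<open>i\<close> has terminated; by soundness every processor alive then has delivered that
  message, and stored entries persist.\<close>

lemma oneTerm_stored:
  assumes "alive n (st R 0) i" "obj m i = Some ob" "oOneTerm ob" "alive n (st R m) k"
  shows "\<exists>ob'. obj m k = Some ob' \<and> oProposals ob' i \<noteq> Bot"
  using assms
proof (induction rule: obj_induct)
  case (fresh m ob)
  then have "obj (Suc m) i \<noteq> obj m i" by simp
  with run_step show ?case
    by (cases rule: step_object_cases)
       (use fresh in \<open>auto simp: fresh_obj_def deliver_eff_def Let_def split: if_splits\<close>)
next
  case (same m ob)
  from same.prems have "alive n (st R m) k" by (auto elim: alive_antimono)
  with same show ?case by (intro stored_mono[of m _ _ "Suc m"]) auto
next
  case (change m ob ob')
  have k: "alive n (st R m) k" using change.prems by (auto elim: alive_antimono)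
  show ?case
  proof (cases "oOneTerm ob")
    case True
    with change k show ?thesis by (intro stored_mono[of m _ _ "Suc m"]) auto
  next
    case False
    from run_step change(3) show ?thesis
    proof (cases rule: step_object_cases)
      case (Loop1 d ob0)
      then obtain d' where d': "oTxDes ob = Some d'" "d' \<in> terminated (st R m) i"
        using change False by (auto simp: line1_eff_def has_terminated_def split: if_splits)
      moreover from d' obtain m' where "m' < m" "urb_broadcasts R m' (PROPOSAL i d' (oV ob))"
        using txDes_broadcast assms(1) change(1) by blast
      ultimately obtain m'' where "m'' < m" "act R m'' = Deliver k (PROPOSAL i d' (oV ob))"
        using urb k unfolding urb_spec_def has_terminated_sound_def urb_delivers_def
        by (metis msg.sel(1,2))
      then show ?thesis using delivered_stored[of m'' k _ "Suc m"] by simp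
    qed (use change False in \<open>auto simp: deliver_eff_def Let_def line2_eff_def split: if_splits\<close>)
  qed
qed

subsection \<open>Binary decisions\<close>

text \<open>Activation and \<open>binPropose\<close> create no decision, so every decided entry goes
  back to an action; agreement and validity speak about such actions.\<close>

lemma decided_act:
  assumes "alive n (st R 0) i" "obj m i = Some ob" "oBC ob k = BCDecided b"
  shows "\<exists>m'<m. act R m' = BCDecide i k b"
  using assms
proof (induction rule: obj_induct)
  case (fresh m ob)
  then have "obj (Suc m) i \<noteq> obj m i" by simp
  with run_step show ?case
    by (cases rule: step_object_cases)
       (use fresh in \<open>auto simp: fresh_obj_def deliver_eff_def Let_def split: if_splits\<close>)
next
  case (change m ob ob')
  from run_step change(3) show ?case
    by (cases rule: step_object_cases)
       (use change in \<open>auto simp: deliver_eff_def Let_def line1_eff_def line2_eff_def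
          intro: less_SucI split: if_splits\<close>)
qed (auto intro: less_SucI)

lemma agreement: "act R m = BCDecide i k b \<Longrightarrow> act R m' = BCDecide i' k b' \<Longrightarrow> b = b'"
  using bc unfolding bc_spec_def bc_agreement_def by blast

lemma bin_proposes_alive: "bin_proposes n var R m j k b \<Longrightarrow> alive n (st R m) j"
  using run_step[of m] by (auto simp: bin_proposes_def)

lemma decision_proposed:
  assumes "act R m = BCDecide i k b"
  obtains m' j where "bin_proposes n var R m' j k b"
  using assms bc unfolding bc_spec_def bc_validity_def by blast

lemma never_decides_False: "\<exists>l. l < n \<and> (\<forall>m i. act R m \<noteq> BCDecide i l False)"
proof (cases "\<exists>m j k b. bin_proposes n var R m j k b")
  case True
  \<comment> \<open>The caller \<open>j\<close> of an earliest invocation has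
    \<open>oOneTerm\<close>; its own index will be the one sought.\<close>
  define M where "M = (LEAST m. \<exists>j k b. bin_proposes n var R m j k b)"
  have "\<exists>j k b. bin_proposes n var R M j k b"
    unfolding M_def using True by (rule LeastI_ex)
  then obtain j k b where M: "bin_proposes n var R M j k b" by blast
  then obtain ob where ob: "obj M j = Some ob" "(k, b) \<in> bin_calls n var ob"
    by (auto simp: bin_proposes_def)
  have "alive n (st R M) j" using M by (rule bin_proposes_alive)
  then have j: "alive n (st R 0) j" "j < n" using alive_antimono by (auto simp: alive_def)
  have "c" if call: "bin_proposes n var R m i j c" for m i c
  proof -
    \<comment> \<open>\<open>i\<close> is alive at the later time \<open>m\<close>, hence already at
      \<open>M\<close>, when every processor alive had stored the proposal of
      \<open>j\<close>.\<close>
    have "M \<le> m" unfolding M_def using call by (blast intro: Least_le)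
    moreover have "alive n (st R m) i" using call by (rule bin_proposes_alive)
    ultimately have "\<exists>ob'. obj M i = Some ob' \<and> oProposals ob' j \<noteq> Bot"
      using oneTerm_stored j ob bin_callsD(3) alive_antimono by blast
    then have "\<exists>ob'. obj m i = Some ob' \<and> oProposals ob' j \<noteq> Bot"
      using \<open>M \<le> m\<close> by (rule stored_mono)
    moreover obtain ob' where "obj m i = Some ob'" "(j, c) \<in> bin_calls n var ob'"
      using call by (auto simp: bin_proposes_def)
    ultimately show c using bin_callsD(4) by fastforce
  qed
  then show ?thesis using j decision_proposed by metis
next
  case False
  \<comment> \<open>Without any invocation, validity rules out every decision, so index
    \<open>0\<close> will do.\<close>
  moreover have "0 < n" using few_crashes by simp
  ultimately show ?thesis using decision_proposed by metis
qed

subsection \<open>Progress of the correct processors\<close>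

text \<open>Asks for \<open>P\<close> from some state on, not just in one state, so that finitely
  many such facts meet in a common state.\<close>

definition ev :: "nat \<Rightarrow> ('v obj \<Rightarrow> bool) \<Rightarrow> bool" where
  "ev j P \<longleftrightarrow> (\<forall>\<^sub>F m in sequentially. \<exists>ob. obj m j = Some ob \<and> P ob)"

lemma evI:
  assumes "obj m j = Some ob" "P ob" "\<And>ob ob'. obj_le ob ob' \<Longrightarrow> P ob \<Longrightarrow> P ob'"
  shows "ev j P"
proof -
  have "\<exists>ob'. obj m' j = Some ob' \<and> P ob'" if "m \<le> m'" for m'
    using obj_mono[OF assms(1) that] assms(2,3) by blast
  then show ?thesis unfolding ev_def eventually_sequentially by blast
qed

lemma ev_conj: "ev j P \<Longrightarrow> ev j Q \<Longrightarrow> ev j (\<lambda>ob. P ob \<and> Q ob)"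
  unfolding ev_def by (erule (1) eventually_elim2) auto

text \<open>The second premise supplies the active object when \<open>x = 0\<close>.\<close>

lemma ev_all_less:
  assumes "\<And>y. y < (x :: nat) \<Longrightarrow> ev j (P y)" "ev j (\<lambda>_. True)"
  shows "ev j (\<lambda>ob. \<forall>y<x. P y ob)"
  using assms(1)
proof (induction x)
  case 0
  then show ?case using assms(2) by simp
next
  case (Suc x)
  then have "ev j (\<lambda>ob. (\<forall>y<x. P y ob) \<and> P x ob)" by (intro ev_conj) auto
  then show ?case by (simp add: less_Suc_eq all_conj_distrib)
qed

lemma ev_active:
  assumes "j \<in> Correct n R"
  shows "ev j (\<lambda>_. True)"
proof -
  obtain m where "(\<exists>v\<in>V. act R m = Propose j (Val v)) \<or> activates R m j"
    using assms proposals unfolding proposes_value_def by blast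
  then have "\<exists>ob. obj (Suc m) j = Some ob"
  proof
    assume "\<exists>v\<in>V. act R m = Propose j (Val v)"
    then show ?thesis using run_step[of m] by (auto simp: set_obj_def propose_eff_def)
  next
    assume "activates R m j"
    then show ?thesis by (auto simp: activates_def)
  qed
  then show ?thesis using evI[where P = "\<lambda>_. True"] by blast
qed

text \<open>Only the loop steps of \<open>i\<close> move its \<open>pc\<close>. This serves to
  exclude two executions of one line with none of the other in between.\<close>

lemma pc_stable:
  assumes "m \<le> m'" and "\<And>k. m \<le> k \<Longrightarrow> k < m' \<Longrightarrow>
    \<not> (act R k = Loop2 i \<and> pc (st R (Suc k)) i \<noteq> l) \<and>
    \<not> (\<exists>d. act R k = Loop1 i d \<and> pc (st R (Suc k)) i \<noteq> l)" and "pc (st R m) i = l"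
  shows "pc (st R m') i = l"
  using assms
proof (induction rule: dec_induct)
  case (step k)
  then have "pc (st R k) i = l" by simp
  then show ?case using step.prems(1)[of k] step.hyps step_pc_cases[OF run_step, of k i] by auto
qed

text \<open>Fairness alone would allow all late loop steps to be of one line. But at an active
  object each execution of a line moves \<open>pc\<close> to the other line, and only executing that
  one moves it back.\<close>

lemma loops_often:
  assumes "j \<in> Correct n R"
  shows "\<exists>m'\<ge>m. act R m' = Loop2 j" and "\<exists>m'\<ge>m. \<exists>d. act R m' = Loop1 j d"
proof -
  have loop: "\<exists>m'\<ge>m. act R m' = Loop2 j \<or> (\<exists>d. act R m' = Loop1 j d)" for m
    using assms exec unfolding execution_def infinite_nat_iff_unbounded_le by blast
  \<comment> \<open>On an inactive object line (1) leaves \<open>pc\<close> at \<open>Line1\<close>;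
    the alternation is certain only once the object is active.\<close>
  obtain m0 where m0: "\<And>m. m \<ge> m0 \<Longrightarrow> \<exists>ob. obj m j = Some ob"
    using ev_active[OF assms] unfolding ev_def eventually_sequentially by blast
  have L1: "pc (st R k) j = Line1 \<and> pc (st R (Suc k)) j = Line2"
    if "act R k = Loop1 j d" "k \<ge> m0" for k d
    using run_step[of k] m0[OF that(2)] that(1) by (auto simp: set_pc_def)
  have L2: "pc (st R k) j = Line2 \<and> pc (st R (Suc k)) j = Line1" if "act R k = Loop2 j" for k
    using run_step[of k] that by (auto simp: set_pc_def)
  show "\<exists>m'\<ge>m. act R m' = Loop2 j"
  proof (rule ccontr)
    assume no: "\<not> ?thesis"
    obtain k d where k: "k \<ge> max m m0" "act R k = Loop1 j d"
      using loop[of "max m m0"] no by auto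
    obtain k' d' where k': "k' \<ge> Suc k" "act R k' = Loop1 j d'"
      using loop[of "Suc k"] no k by (metis Suc_leD max.boundedE order_trans)
    have "pc (st R k') j = Line2"
      by (rule pc_stable[OF k'(1)]) (use no L1 k in auto)
    then show False using L1[OF k'(2)] k k' by simp
  qed
  show "\<exists>m'\<ge>m. \<exists>d. act R m' = Loop1 j d"
  proof (rule ccontr)
    assume no: "\<not> ?thesis"
    obtain k where k: "k \<ge> m" "act R k = Loop2 j"
      using loop[of m] no by auto
    obtain k' where k': "k' \<ge> Suc k" "act R k' = Loop2 j"
      using loop[of "Suc k"] no k by (metis Suc_leD order_trans)
    have "pc (st R k') j = Line1"
      by (rule pc_stable[OF k'(1)]) (use no L2 k in auto)
    then show False using L2[OF k'(2)] by simp
  qed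
qed

lemma Loop1_obj:
  "act R m = Loop1 j d \<Longrightarrow> obj m j = Some ob \<Longrightarrow>
    obj (Suc m) j = Some (line1_eff (terminated (st R m) j) d ob)"
  using run_step[of m] by (auto simp: set_obj_def set_pc_def)

text \<open>Line (1) replaces a descriptor only after it has terminated, and that very step sets
  \<open>oOneTerm\<close>.\<close>

lemma txDes_stable:
  assumes "m \<le> m'" "obj m j = Some ob" "oTxDes ob = Some d" "alive n (st R 0) j"
  shows "\<exists>ob'. obj m' j = Some ob' \<and> (oOneTerm ob' \<or> oTxDes ob' = Some d)"
  using assms(1)
proof (induction rule: dec_induct)
  case base
  then show ?case using assms by simp
next
  case (step m')
  then obtain ob' where ob': "obj m' j = Some ob'" "oOneTerm ob' \<or> oTxDes ob' = Some d" by blast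
  show ?case
  proof (cases "obj (Suc m') j = obj m' j")
    case False
    with run_step show ?thesis
      by (cases rule: step_object_cases)
         (use ob' in \<open>auto simp: line1_eff_def line1_guard_def line2_eff_def deliver_eff_def Let_def\<close>)
  qed (use ob' in auto)
qed

text \<open>An execution of line (1) leaves a descriptor, which terminates for good at a correct
  sender; an execution after that finds the flag set or sets it.\<close>

lemma ev_oneTerm:
  assumes "j \<in> Correct n R"
  shows "ev j oOneTerm"
proof -
  have j: "alive n (st R 0) j" using Correct_alive assms by blast
  obtain m0 where m0: "\<And>m. m \<ge> m0 \<Longrightarrow> \<exists>ob. obj m j = Some ob"
    using ev_active[OF assms] unfolding ev_def eventually_sequentially by blast
  have proper: "oV ob \<noteq> Bot" if "obj m j = Some ob" for m ob
    using oV_proper[OF j that] by auto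
  obtain m1 d1 where m1: "m1 \<ge> m0" "act R m1 = Loop1 j d1" using loops_often(2) assms by blast
  then obtain ob1 where ob1: "obj m1 j = Some ob1" using m0 by blast
  have "obj (Suc m1) j = Some (line1_eff (terminated (st R m1) j) d1 ob1)"
    using Loop1_obj m1 ob1 by blast
  \<comment> \<open>If the guard fails although \<open>oV\<close> is not \<open>Bot\<close>, a
    descriptor is already present.\<close>
  moreover have "\<exists>d. oTxDes (line1_eff (terminated (st R m1) j) d1 ob1) = Some d"
    using proper[OF ob1] by (auto simp: line1_eff_def line1_guard_def)
  ultimately obtain ob2 d where ob2: "obj (Suc m1) j = Some ob2" "oTxDes ob2 = Some d" by blast
  then obtain m' where m': "\<And>m''. m'' \<ge> m' \<Longrightarrow> d \<in> terminated (st R m'') j"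
    using txDes_broadcast[OF j ob2] urb assms
    unfolding urb_spec_def has_terminated_live_def by (metis msg.sel(1,2))
  obtain m3 d3 where m3: "m3 \<ge> max (Suc m1) m'" "act R m3 = Loop1 j d3"
    using loops_often(2) assms by blast
  then obtain ob3 where ob3: "obj m3 j = Some ob3" "oOneTerm ob3 \<or> oTxDes ob3 = Some d"
    using txDes_stable[OF _ ob2 j] by (metis max.boundedE)
  have "oOneTerm (line1_eff (terminated (st R m3) j) d3 ob3)"
    using ob3 proper m3 m'[of m3]
    by (auto simp: line1_eff_def line1_guard_def has_terminated_def)
  then show ?thesis
    using Loop1_obj[OF m3(2) ob3(1)] by (intro evI) (auto simp: obj_le_def)
qed

lemma ev_decided:
  assumes j: "j \<in> Correct n R" and "k < n"
    and "\<exists>m ob. obj m j = Some ob \<and> oBC ob k \<noteq> BCBot"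
  shows "\<exists>b. (\<exists>m. act R m = BCDecide j k b) \<and> ev j (\<lambda>ob. oBC ob k = BCDecided b)"
proof -
  obtain m ob where ob: "obj m j = Some ob" "bc_result (oBC ob k) \<noteq> None"
    using assms bc unfolding bc_spec_def bc_termination_def by blast
  have decided: "\<exists>b m'. oBC ob k = BCDecided b \<and> act R m' = BCDecide j k b"
    if "obj m j = Some ob" "bc_result (oBC ob k) \<noteq> None" for m ob
    using that decided_act[OF Correct_alive[OF j] that(1)] by (cases "oBC ob k") auto
  obtain b m' where b: "act R m' = BCDecide j k b" using decided[OF ob] by blast
  \<comment> \<open>\<open>obj_le\<close> preserves having decided but not the decided value;
    agreement supplies the latter.\<close>
  have "ev j (\<lambda>ob. bc_result (oBC ob k) \<noteq> None)"
    using ob by (rule evI) (simp add: obj_le_def)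
  moreover have "oBC ob k = BCDecided b" if "obj m j = Some ob" "bc_result (oBC ob k) \<noteq> None"
    for m ob
    using decided[OF that] agreement b by blast
  ultimately have "ev j (\<lambda>ob. oBC ob k = BCDecided b)"
    unfolding ev_def by (auto elim!: eventually_mono)
  then show ?thesis using b by blast
qed

text \<open>Once all lower objects have decided \<open>False\<close> and \<open>oOneTerm\<close>
  holds, an execution of line (2) activates object \<open>l\<close> unless it is active already;
  then termination applies.\<close>

lemma ev_next_decided:
  assumes j: "j \<in> Correct n R" and "l < n"
    and "\<And>y. y < l \<Longrightarrow> ev j (\<lambda>ob. oBC ob y = BCDecided False)"
  shows "\<exists>b. (\<exists>m. act R m = BCDecide j l b) \<and> ev j (\<lambda>ob. oBC ob l = BCDecided b)"
proof -
  have "ev j (\<lambda>ob. (\<forall>y<l. oBC ob y = BCDecided False) \<and> oOneTerm ob)"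
    using assms ev_active ev_oneTerm by (intro ev_conj ev_all_less) auto
  then obtain m0 where m0: "\<And>m. m \<ge> m0 \<Longrightarrow> \<exists>ob. obj m j = Some ob \<and>
      (\<forall>y<l. oBC ob y = BCDecided False) \<and> oOneTerm ob"
    unfolding ev_def eventually_sequentially by blast
  obtain m where m: "m \<ge> m0" "act R m = Loop2 j" using loops_often(1) j by blast
  then obtain ob where ob: "obj m j = Some ob" "\<And>y. y < l \<Longrightarrow> oBC ob y = BCDecided False"
    "oOneTerm ob" using m0 by blast
  have "\<exists>m ob. obj m j = Some ob \<and> oBC ob l \<noteq> BCBot"
  proof (cases "oBC ob l = BCBot")
    case True
    then have "l \<in> fst ` bin_calls n var ob" using bin_calls_next ob \<open>l < n\<close> by blast
    moreover have "obj (Suc m) j = Some (line2_eff n var ob)"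
      using run_step[of m] m ob by (simp add: set_obj_def set_pc_def)
    ultimately show ?thesis by (intro exI[of _ "Suc m"]) (simp add: line2_eff_def)
  qed (use ob in blast)
  then show ?thesis by (rule ev_decided[OF j \<open>l < n\<close>])
qed

text \<open>This is where the broadcast has to be uniform: the delivering processor \<open>i\<close>
  may crash later.\<close>

lemma ev_stored:
  assumes "act R m = Deliver i msg" "j \<in> Correct n R"
  shows "ev j (\<lambda>ob. oProposals ob (sender msg) \<noteq> Bot)"
proof -
  obtain m' where "act R m' = Deliver j msg"
    using assms urb unfolding urb_spec_def urb_termination_def urb_delivers_def by blast
  then obtain ob where "obj (Suc m') j = Some ob" "oProposals ob (sender msg) \<noteq> Bot"
    using delivered_stored by blast
  then show ?thesis by (rule evI) (simp add: obj_le_def)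
qed

section \<open>The common result of the correct processors\<close>

lemma results_agree:
  "\<exists>v. v \<notin> {Bot, Err} \<and>
     (\<forall>j\<in>Correct n R. \<exists>m. \<forall>m'\<ge>m. result n (obj m' j) = v)"
proof -
  define l where "l = (LEAST l. l < n \<and> (\<forall>m i. act R m \<noteq> BCDecide i l False))"
  have l: "l < n" "\<And>m i. act R m \<noteq> BCDecide i l False"
    using LeastI_ex[OF never_decides_False] unfolding l_def by blast+
  have below: "\<exists>m i. act R m = BCDecide i y False" if "y < l" for y
    using that l(1) not_less_Least[of y "\<lambda>l. l < n \<and> (\<forall>m i. act R m \<noteq> BCDecide i l False)"]
    unfolding l_def by auto
  \<comment> \<open>By induction on \<open>y\<close>, as \<open>ev_next_decided\<close> needs the
    decisions of all lower objects; agreement with the decision from \<open>below\<close> makes the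
    local one \<open>False\<close>.\<close>
  have evFalse: "ev j (\<lambda>ob. oBC ob y = BCDecided False)" if "j \<in> Correct n R" "y < l" for j y
    using that(2)
  proof (induction y rule: less_induct)
    case (less y)
    then show ?case
      using ev_next_decided[OF that(1), of y] l(1) below[of y] agreement by force
  qed
  have evTrue: "(\<exists>m. act R m = BCDecide j l True) \<and> ev j (\<lambda>ob. oBC ob l = BCDecided True)"
    if "j \<in> Correct n R" for j
    using ev_next_decided[OF that l(1) evFalse[OF that]] l(2) by (metis (full_types))
  \<comment> \<open>\<open>2 * t < n\<close> leaves a correct processor, whose decision on object
    \<open>l\<close> shows that \<open>True\<close> was proposed there.\<close>
  have "Correct n R \<noteq> {}"
    using exec few_crashes unfolding execution_def by force
  then obtain m i where "act R m = BCDecide i l True" using evTrue by blast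
  then obtain m p where p: "bin_proposes n var R m p l True" using decision_proposed by blast
  then obtain ob where ob: "obj m p = Some ob" "(l, True) \<in> bin_calls n var ob"
    by (auto simp: bin_proposes_def)
  \<comment> \<open>The proposer \<open>p\<close> may be faulty; its entry for \<open>l\<close>
    provides the common value.\<close>
  have stored: "alive n (st R 0) p" "obj m p = Some ob" "oProposals ob l \<noteq> Bot"
    using bin_proposes_alive[OF p] alive_antimono ob bin_callsD(4)[OF ob(2)] by blast+
  then obtain m' msg where msg: "act R m' = Deliver p msg" "sender msg = l"
    using stored_delivered by blast
  have "\<exists>m. \<forall>m'\<ge>m. result n (obj m' j) = oProposals ob l" if j: "j \<in> Correct n R" for j
  proof -
    have alive: "alive n (st R 0) j" using Correct_alive j by blast
    have "ev j (\<lambda>ob. (\<forall>y<l. oBC ob y = BCDecided False) \<and>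
        oBC ob l = BCDecided True \<and> oProposals ob l \<noteq> Bot)"
      using evFalse evTrue ev_active j ev_stored[OF msg(1) j] msg(2)
      by (intro ev_conj ev_all_less) auto
    moreover have "result n (obj m' j) = oProposals ob l"
      if o': "obj m' j = Some ob'" "\<forall>y<l. oBC ob' y = BCDecided False"
        "oBC ob' l = BCDecided True" "oProposals ob' l \<noteq> Bot" for m' ob'
    proof -
      \<comment> \<open>\<open>l\<close> is the first index outside \<open>Kset n ob'\<close>, so
        \<open>result\<close> reads entry \<open>l\<close>.\<close>
      have "kk n ob' = int l - 1" using o' l(1) by (intro kk_eqI) (auto simp: Kset_def)
      moreover have "oV ob' \<noteq> Bot" using oV_proper[OF alive o'(1)] by auto
      moreover have "oProposals ob' l = oProposals ob l"
        using stored_unique_value(1)[OF alive o'(1,4) stored] .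
      ultimately show ?thesis using o' l(1) by (simp add: result_def)
    qed
    ultimately show ?thesis unfolding ev_def eventually_sequentially by metis
  qed
  moreover have "oProposals ob l \<notin> {Bot, Err}"
    using stored_unique_value(2)[OF stored stored] by auto
  ultimately show ?thesis by blast
qed

section \<open>Counting the invocations of binary consensus\<close>

text \<open>A call activates its object for good, and calls go only to inactive objects.\<close>

lemma bin_proposes_once:
  assumes "bin_proposes n var R m j k b" "bin_proposes n var R m' j k b'"
  shows "m = m'"
proof -
  have "\<not> m < m'" if mm': "bin_proposes n var R m j k b" "bin_proposes n var R m' j k b'" for m m' b b'
  proof
    assume "m < m'"
    obtain ob where ob: "act R m = Loop2 j" "obj m j = Some ob" "(k, b) \<in> bin_calls n var ob"
      using mm'(1) by (auto simp: bin_proposes_def)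
    then have "obj (Suc m) j = Some (line2_eff n var ob)"
      using run_step[of m] by (simp add: set_obj_def set_pc_def)
    moreover have "oBC (line2_eff n var ob) k \<noteq> BCBot"
      using imageI[OF ob(3), of fst] by (simp add: line2_eff_def)
    moreover obtain ob' where ob': "obj m' j = Some ob'" "(k, b') \<in> bin_calls n var ob'"
      using mm'(2) by (auto simp: bin_proposes_def)
    ultimately have "oBC ob' k \<noteq> BCBot"
      using obj_leI[of "Suc m" j "line2_eff n var ob" m' ob'] \<open>m < m'\<close> by (simp add: obj_le_def)
    then show False using bin_callsD(2)[OF ob'(2)] by simp
  qed
  then show ?thesis using assms by (metis linorder_neqE_nat)
qed

lemma bin_invocations_bound:
  "finite (bin_invocations n var R j) \<and> card (bin_invocations n var R j) \<le> n"
proof -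
  \<comment> \<open>Each object index occurs in at most one invocation by \<open>j\<close>, and
    there are only \<open>n\<close> indices.\<close>
  have "inj_on snd (bin_invocations n var R j)"
    by (auto simp: inj_on_def bin_invocations_def dest: bin_proposes_once)
  moreover have "snd ` bin_invocations n var R j \<subseteq> {..<n}"
    using bin_callsD(1) by (force simp: bin_invocations_def bin_proposes_def)
  ultimately show ?thesis
    by (metis card_lessThan card_image card_mono finite_imageD finite_lessThan finite_subset)
qed

end

theorem lemma6p7:
  fixes n t cap a i :: nat and V :: "'v set" and var :: variant
    and R :: "'v run" and v\<^sub>i :: "'v sym"
  assumes "finite V"
    and "2 * t < n"
    and "execution n t cap V var R"
    and "urb_spec n R"
    and "bc_spec n var R"
    and "authentic n R"
    and "\<forall>j\<in>Correct n R. proposes_value n V R j"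
    and "i < n"
    and "first_propose R a i v\<^sub>i"
    and "v\<^sub>i \<noteq> Bot"
  shows "\<exists>v. v \<notin> {Bot, Err} \<and>
     (\<forall>j\<in>Correct n R. \<exists>m. \<forall>m'\<ge>m. result n (objects (st R m') j) = v) \<and>
     (\<forall>j<n. finite (bin_invocations n var R j) \<and> card (bin_invocations n var R j) \<le> n)"
proof -
  interpret authentic_run n t cap V var R
    using assms by unfold_locales
  show ?thesis using results_agree bin_invocations_bound by blast
qed

end
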